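(* (i) For $H\in(0,1/2)\cup(1/2,3/4)$, the statistic $$\hat a_k^2=2^{k(2\widetilde H_k^{(2)}-1)}T^{-2\widetilde H_k^{(2)}}\left(1-2^{1-2\widetilde H_k^{(2)}}\right)^{-1}U_k^{H,2}$$ is a strongly consistent estimator of $a^2$, i.e. $\hat a_k^2\to a^2$ almost surely as $k\to\infty$. (ii) For $H\in(1/2,1)$, the statistic $$\hat b_k^2=\frac{V_{2^k}^{H,2}}T$$ is a strongly consistent estimator of $b^2$, i.e. $\hat b_k^2\to b^2$ almost surely as $k\to\infty$.
   Context: Mixed model: $M_t^H=aB_t^H+bW_t$, $t\in[0,T]$, where $T>0$, $a>0$, $b>0$, $W$ is a standard Wiener process and $B^H$ is a fractional Brownian motion with Hurst parameter $H$ (centered Gaussian, $\mathsf{E}[B^H_tB^H_s]=\frac12(t^{2H}+s^{2H}-|t-s|^{2H})$), independent of $W$. For $n\ge1$, $\Delta_i^nX=X_{T(i+1)/n}-X_{Ti/n}$, $i=0,\dots,n-1$; $V_n^{H,2}=\sum_{i=0}^{n-1}(\Delta_i^nM^H)^2$; $U_k^{H,2}=V_{2^k}^{H,2}-V_{2^{k+1}}^{H,2}$; $\log_{2+}x=\log_2x$ for $x>0$ and $\log_{2+}x=0$ for $x\le0$; and $$\widetilde H_k^{(2)}=\frac12\left(\log_{2+}\frac{U_k^{H,2}}{U_{k+1}^{H,2}}+1\right).$$ *)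

theory Defs
  imports "HOL-Probability.Probability"
begin

text \<open>Gaussian laws may be degenerate: a fractional Brownian motion vanishes at time 0, so the
  constants (the case \<open>N(\<mu>, 0)\<close>) have to be included.\<close>

definition (in prob_space) gaussian_rv :: "('a \<Rightarrow> real) \<Rightarrow> bool" where
  "gaussian_rv X \<longleftrightarrow> random_variable borel X \<and>
     (\<exists>\<mu> \<sigma>. (\<sigma> > 0 \<and> distributed M lborel X (normal_density \<mu> \<sigma>)) \<or> (AE \<omega> in M. X \<omega> = \<mu>))"

definition (in prob_space) gaussian_process :: "real set \<Rightarrow> (real \<Rightarrow> 'a \<Rightarrow> real) \<Rightarrow> bool" where
  "gaussian_process I X \<longleftrightarrow>
     (\<forall>J c. finite J \<longrightarrow> J \<subseteq> I \<longrightarrow> gaussian_rv (\<lambda>\<omega>. \<Sum>t\<in>J. c t * X t \<omega>))"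

text \<open>No path regularity is assumed of the fractional Brownian motion. The time horizon is
  \<open>[0, T]\<close>; the values of the processes outside it are irrelevant.\<close>

definition (in prob_space) fractional_brownian_motion ::
    "real \<Rightarrow> real \<Rightarrow> (real \<Rightarrow> 'a \<Rightarrow> real) \<Rightarrow> bool" where
  "fractional_brownian_motion T H B \<longleftrightarrow> 0 < H \<and> H < 1 \<and> gaussian_process {0..T} B \<and>
     (\<forall>t\<in>{0..T}. expectation (B t) = 0) \<and>
     (\<forall>s\<in>{0..T}. \<forall>t\<in>{0..T}. expectation (\<lambda>\<omega>. B t \<omega> * B s \<omega>) =
        1/2 * (t powr (2*H) + s powr (2*H) - \<bar>t - s\<bar> powr (2*H)))"

definition (in prob_space) wiener_process :: "real \<Rightarrow> (real \<Rightarrow> 'a \<Rightarrow> real) \<Rightarrow> bool" where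
  "wiener_process T W \<longleftrightarrow>
     (\<forall>t\<in>{0..T}. random_variable borel (W t)) \<and>
     (AE \<omega> in M. W 0 \<omega> = 0) \<and>
     (\<forall>(n::nat) t. strict_mono_on {..n} t \<longrightarrow> t ` {..n} \<subseteq> {0..T} \<longrightarrow>
        indep_vars (\<lambda>_. borel) (\<lambda>i \<omega>. W (t (Suc i)) \<omega> - W (t i) \<omega>) {..<n}) \<and>
     (\<forall>s t. 0 \<le> s \<longrightarrow> s < t \<longrightarrow> t \<le> T \<longrightarrow>
        distributed M lborel (\<lambda>\<omega>. W t \<omega> - W s \<omega>) (normal_density 0 (sqrt (t - s)))) \<and>
     (AE \<omega> in M. continuous_on {0..T} (\<lambda>t. W t \<omega>))"

definition (in prob_space) indep_processes ::
    "real set \<Rightarrow> (real \<Rightarrow> 'a \<Rightarrow> real) \<Rightarrow> (real \<Rightarrow> 'a \<Rightarrow> real) \<Rightarrow> bool" where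
  "indep_processes I X Y \<longleftrightarrow>
     indep_var (Pi\<^sub>M I (\<lambda>_. borel)) (\<lambda>\<omega>. \<lambda>t\<in>I. X t \<omega>) (Pi\<^sub>M I (\<lambda>_. borel)) (\<lambda>\<omega>. \<lambda>t\<in>I. Y t \<omega>)"

definition mixed_process ::
    "real \<Rightarrow> real \<Rightarrow> (real \<Rightarrow> 'a \<Rightarrow> real) \<Rightarrow> (real \<Rightarrow> 'a \<Rightarrow> real) \<Rightarrow> real \<Rightarrow> 'a \<Rightarrow> real" where
  "mixed_process a b B W t \<omega> = a * B t \<omega> + b * W t \<omega>"

text \<open>The statistics below are functions of an arbitrary process \<open>X\<close> observed on \<open>[0, T]\<close>;
  they do not involve the parameters \<open>a\<close>, \<open>b\<close>, \<open>H\<close>.\<close>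

definition increment :: "real \<Rightarrow> (real \<Rightarrow> 'a \<Rightarrow> real) \<Rightarrow> nat \<Rightarrow> nat \<Rightarrow> 'a \<Rightarrow> real" where
  "increment T X n i \<omega> = X (T * (real i + 1) / real n) \<omega> - X (T * real i / real n) \<omega>"

definition quadratic_variation :: "real \<Rightarrow> (real \<Rightarrow> 'a \<Rightarrow> real) \<Rightarrow> nat \<Rightarrow> 'a \<Rightarrow> real" where
  "quadratic_variation T X n \<omega> = (\<Sum>i<n. (increment T X n i \<omega>)\<^sup>2)"

definition U_stat :: "real \<Rightarrow> (real \<Rightarrow> 'a \<Rightarrow> real) \<Rightarrow> nat \<Rightarrow> 'a \<Rightarrow> real" where
  "U_stat T X k \<omega> =
     quadratic_variation T X (2 ^ k) \<omega> - quadratic_variation T X (2 ^ (k + 1)) \<omega>"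

definition log2_plus :: "real \<Rightarrow> real" where
  "log2_plus x = (if x > 0 then log 2 x else 0)"

text \<open>Where the quotient by \<open>U_stat T X (k + 1) \<omega>\<close>, or in \<open>a_hat_sq\<close> the inverse of
  \<open>1 - 2 powr (1 - 2 * h)\<close>, is undefined, the convention \<open>x / 0 = 0\<close> applies.\<close>

definition H_tilde :: "real \<Rightarrow> (real \<Rightarrow> 'a \<Rightarrow> real) \<Rightarrow> nat \<Rightarrow> 'a \<Rightarrow> real" where
  "H_tilde T X k \<omega> = 1/2 * (log2_plus (U_stat T X k \<omega> / U_stat T X (k + 1) \<omega>) + 1)"

definition a_hat_sq :: "real \<Rightarrow> (real \<Rightarrow> 'a \<Rightarrow> real) \<Rightarrow> nat \<Rightarrow> 'a \<Rightarrow> real" where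
  "a_hat_sq T X k \<omega> = (let h = H_tilde T X k \<omega> in
     2 powr (real k * (2 * h - 1)) * T powr (- 2 * h) * inverse (1 - 2 powr (1 - 2 * h))
       * U_stat T X k \<omega>)"

definition b_hat_sq :: "real \<Rightarrow> (real \<Rightarrow> 'a \<Rightarrow> real) \<Rightarrow> nat \<Rightarrow> 'a \<Rightarrow> real" where
  "b_hat_sq T X k \<omega> = quadratic_variation T X (2 ^ k) \<omega> / T"

definition (in prob_space) strongly_consistent :: "(nat \<Rightarrow> 'a \<Rightarrow> real) \<Rightarrow> real \<Rightarrow> bool" where
  "strongly_consistent est \<theta> \<longleftrightarrow> (AE \<omega> in M. (\<lambda>k. est k \<omega>) \<longlonglongrightarrow> \<theta>)"

end

theory Submission
  imports Defs
begin

text \<open>Write \<open>n = 2 ^ k\<close> and \<open>q = 2 powr (1 - 2 * H)\<close>. The quadratic variation of the mixed process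
  splits into \<open>a\<^sup>2\<close> times that of \<open>B\<close>, with mean \<open>T powr (2 * H) * q ^ k\<close>, \<open>b\<^sup>2\<close> times that of
  \<open>W\<close>, with mean \<open>T\<close>, and a centred cross term. For \<open>H > 1/2\<close> the means of the first part are
  summable, so it vanishes almost surely, and by Cauchy-Schwarz so does the cross term; this is (ii).
  For (i), the constant \<open>b\<^sup>2 * T\<close> cancels in \<open>U_stat\<close>, and for \<open>H < 3/4\<close> the second moments of
  the three fluctuations are of geometric order smaller than \<open>q ^ (2 * k)\<close>. Hence \<open>U_stat\<close> equals
  \<open>a\<^sup>2 * T powr (2 * H) * (1 - q) * q ^ k\<close> up to a relative error \<open>o(1/k)\<close>.

  The variance for \<open>B\<close> is twice the sum of the squared covariances of the increments. No asymptotics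
  of the covariances are needed: off the diagonal they have a constant sign (the powers
  with exponent \<open>2 * H\<close> are convex or concave), and their sum is the variance of \<open>B T\<close>.\<close>

section \<open>Almost sure convergence from moment bounds\<close>

text \<open>The expectation of the series of the \<open>Y k\<close> is the finite sum of the
  \<open>m k\<close>, so the series converges almost surely and its terms tend to 0.\<close>

lemma (in prob_space) AE_tendsto_0_if_summable_expectation:
  fixes Y :: "nat \<Rightarrow> 'a \<Rightarrow> real"
  assumes Y: "\<And>k. has_bochner_integral M (Y k) (m k)" and nonneg: "\<And>k \<omega>. 0 \<le> Y k \<omega>"
    and m: "summable m"
  shows "AE \<omega> in M. (\<lambda>k. Y k \<omega>) \<longlonglongrightarrow> 0"
proof -
  note [measurable] = borel_measurable_has_bochner_integral[OF Y]
  have eq: "(\<integral>\<^sup>+ \<omega>. ennreal (Y k \<omega>) \<partial>M) = ennreal (m k)" for k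
    using Y[of k] nonneg nn_integral_eq_integral[of M "Y k"] by (simp add: has_bochner_integral_iff)
  have m0: "0 \<le> m k" for k
    using nonneg by (simp flip: has_bochner_integral_integral_eq[OF Y])
  have "(\<integral>\<^sup>+ \<omega>. (\<Sum>k. ennreal (Y k \<omega>)) \<partial>M) = (\<Sum>k. ennreal (m k))"
    by (subst nn_integral_suminf) (auto simp: eq)
  also have "\<dots> = ennreal (suminf m)"
    using m m0 by (rule suminf_ennreal2[rotated])
  finally have "AE \<omega> in M. (\<Sum>k. ennreal (Y k \<omega>)) \<noteq> \<infinity>"
    by (intro nn_integral_PInf_AE) auto
  then show ?thesis
    by eventually_elim (use nonneg in \<open>auto intro!: summable_LIMSEQ_zero summable_suminf_not_top\<close>)
qed

text \<open>With \<open>z\<close> the fourth root of \<open>x\<close>, one factor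
  \<open>z ^ (2 * k)\<close> absorbs \<open>k\<^sup>2\<close>; the other is a geometric
  majorant.\<close>

lemma summable_square_times_power:
  fixes x :: real
  assumes "0 \<le> x" "x < 1"
  shows "summable (\<lambda>k. (real k)\<^sup>2 * x ^ k)"
proof (cases "x = 0")
  case True
  then have "(\<lambda>k. (real k)\<^sup>2 * x ^ k) = (\<lambda>_. 0)"
    by (auto simp: power_0_left)
  then show ?thesis by simp
next
  case False
  with assms have x: "0 < x" "x < 1" by auto
  define z where "z = x powr (1/4)"
  have z: "0 < z" "z < 1" "z ^ 4 = x"
    using x powr_less_mono2[of "1/4" x 1] by (simp_all add: z_def powr_power)
  have lim: "(\<lambda>k. (real k * z ^ k)\<^sup>2) \<longlonglongrightarrow> 0"
    using z powser_times_n_limit_0[of z] by (intro tendsto_null_power) auto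
  have "\<forall>\<^sub>F k in sequentially. norm ((real k)\<^sup>2 * x ^ k) \<le> (z\<^sup>2) ^ k"
    using order_tendstoD(2)[OF lim zero_less_one]
  proof eventually_elim
    case (elim k)
    have "(real k)\<^sup>2 * x ^ k = (real k * z ^ k)\<^sup>2 * (z\<^sup>2) ^ k"
      by (simp flip: z(3) add: power_mult_distrib power_mult[symmetric] power_add[symmetric])
    also have "\<dots> \<le> 1 * (z\<^sup>2) ^ k"
      using elim z by (intro mult_right_mono) auto
    finally show ?case using x by simp
  qed
  moreover have "summable (\<lambda>k. (z\<^sup>2) ^ k)"
    using z by (intro summable_geometric) (simp add: power_less_one_iff)
  ultimately show ?thesis
    by (rule summable_comparison_test_ev)
qed

text \<open>The second moments of the normalised variables are at most
  \<open>C * k\<^sup>2 * (r / q\<^sup>2) ^ k\<close>, which is summable. The factor \<open>k\<close>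
  in the conclusion yields the relative error \<open>o(1/k)\<close>.\<close>

lemma (in prob_space) AE_tendsto_0_if_second_moment_decay:
  fixes X :: "nat \<Rightarrow> 'a \<Rightarrow> real"
  assumes X: "\<And>k. has_bochner_integral M (\<lambda>\<omega>. (X k \<omega>)\<^sup>2) (m k)"
    and m: "\<And>k. m k \<le> C * r ^ k" and r: "0 \<le> r" "r < q\<^sup>2" and q: "0 < q"
  shows "AE \<omega> in M. (\<lambda>k. real k * X k \<omega> / q ^ k) \<longlonglongrightarrow> 0"
proof -
  have m0: "0 \<le> m k" for k
    by (simp flip: has_bochner_integral_integral_eq[OF X])
  have "AE \<omega> in M. (\<lambda>k. (real k * X k \<omega> / q ^ k)\<^sup>2) \<longlonglongrightarrow> 0"
  proof (rule AE_tendsto_0_if_summable_expectation)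
    show "has_bochner_integral M (\<lambda>\<omega>. (real k * X k \<omega> / q ^ k)\<^sup>2) ((real k / q ^ k)\<^sup>2 * m k)" for k
      using has_bochner_integral_mult_right[OF X[of k], of "(real k / q ^ k)\<^sup>2"]
      by (simp add: power_mult_distrib power_divide)
    have "summable (\<lambda>k. C * ((real k)\<^sup>2 * (r / q\<^sup>2) ^ k))"
      using r q by (intro summable_mult summable_square_times_power) auto
    then show "summable (\<lambda>k. (real k / q ^ k)\<^sup>2 * m k)"
    proof (rule summable_comparison_test')
      show "norm ((real k / q ^ k)\<^sup>2 * m k) \<le> C * ((real k)\<^sup>2 * (r / q\<^sup>2) ^ k)" if "k \<ge> 0" for k
      proof -
        have "(real k / q ^ k)\<^sup>2 * m k \<le> (real k / q ^ k)\<^sup>2 * (C * r ^ k)"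
          using m[of k] by (intro mult_left_mono) auto
        also have "\<dots> = C * ((real k)\<^sup>2 * (r / q\<^sup>2) ^ k)"
          by (simp add: power_divide power_mult[symmetric] mult.commute[of 2])
        finally show ?thesis
          using m0[of k] by simp
      qed
    qed
  qed auto
  then show ?thesis
    by eventually_elim (simp add: power_tendsto_0_iff)
qed

section \<open>Gaussian moments\<close>

lemma has_bochner_integral_square_sum:
  fixes X :: "'i \<Rightarrow> 'a \<Rightarrow> real"
  assumes "\<And>i j. i \<in> I \<Longrightarrow> j \<in> I \<Longrightarrow> has_bochner_integral M (\<lambda>\<omega>. X i \<omega> * X j \<omega>) (c i j)"
  shows "has_bochner_integral M (\<lambda>\<omega>. (\<Sum>i\<in>I. X i \<omega>)\<^sup>2) (\<Sum>i\<in>I. \<Sum>j\<in>I. c i j)"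
  unfolding power2_eq_square sum_product
  by (intro has_bochner_integral_sum assms)

lemma (in prob_space) has_bochner_integral_normal_moments:
  assumes X: "distributed M lborel X (normal_density 0 \<sigma>)" and \<sigma>: "0 < \<sigma>"
  shows "has_bochner_integral M X 0"
    and "has_bochner_integral M (\<lambda>\<omega>. (X \<omega>)\<^sup>2) (\<sigma>\<^sup>2)"
    and "has_bochner_integral M (\<lambda>\<omega>. (X \<omega>) ^ 4) (3 * (\<sigma>\<^sup>2)\<^sup>2)"
proof -
  have tr: "has_bochner_integral M (\<lambda>\<omega>. g (X \<omega>)) v"
    if "has_bochner_integral lborel (\<lambda>x. normal_density 0 \<sigma> x * g x) v" "g \<in> borel_measurable borel" for g v
    using distributed_integral[OF X, of g] distributed_integrable[OF X, of g] that
    by (auto simp: has_bochner_integral_iff)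
  show "has_bochner_integral M X 0"
    by (rule tr[of "\<lambda>x. x"]) (use normal_moment_odd[OF \<sigma>, of 0 0] in auto)
  show "has_bochner_integral M (\<lambda>\<omega>. (X \<omega>)\<^sup>2) (\<sigma>\<^sup>2)"
    by (rule tr[of "\<lambda>x. x\<^sup>2"]) (use normal_moment_even[OF \<sigma>, of 0 1] in auto)
  \<comment> \<open>The even moment formula
    \<open>fact (2 * k) / ((2 / \<sigma>\<^sup>2) ^ k * fact k)\<close> at
    \<open>k = 2\<close>.\<close>
  have "fact 4 / ((2 / \<sigma>\<^sup>2)\<^sup>2 * fact 2) = 3 * (\<sigma>\<^sup>2)\<^sup>2"
    using \<sigma> by (simp add: fact_numeral field_simps)
  then show "has_bochner_integral M (\<lambda>\<omega>. (X \<omega>) ^ 4) (3 * (\<sigma>\<^sup>2)\<^sup>2)"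
    by (intro tr[of "\<lambda>x. x ^ 4"]) (use normal_moment_even[OF \<sigma>, of 0 2] in auto)
qed

text \<open>A constant with mean 0 fits the same pattern with \<open>v = 0\<close>, so later
  arguments need no case distinction for degenerate laws.\<close>

lemma (in prob_space) gaussian_rv_moments:
  assumes X: "gaussian_rv X" and E: "expectation X = 0"
  obtains v where "has_bochner_integral M X 0" "has_bochner_integral M (\<lambda>\<omega>. (X \<omega>)\<^sup>2) v"
    "has_bochner_integral M (\<lambda>\<omega>. (X \<omega>) ^ 4) (3 * v\<^sup>2)"
proof -
  note [measurable] = conjunct1[OF X[unfolded gaussian_rv_def]]
  from X obtain \<mu> \<sigma> where
    "0 < \<sigma> \<and> distributed M lborel X (normal_density \<mu> \<sigma>) \<or> (AE \<omega> in M. X \<omega> = \<mu>)"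
    unfolding gaussian_rv_def by blast
  then show thesis
  proof
    assume *: "0 < \<sigma> \<and> distributed M lborel X (normal_density \<mu> \<sigma>)"
    then have "\<mu> = 0"
      using normal_distributed_expectation[of \<sigma> X \<mu>] E by auto
    with * show thesis
      using has_bochner_integral_normal_moments[of X \<sigma>] that by blast
  next
    assume *: "AE \<omega> in M. X \<omega> = \<mu>"
    then have "expectation X = \<mu>"
      by (subst integral_cong_AE[where g="\<lambda>_. \<mu>"]) (auto simp: prob_space)
    with * E have **: "AE \<omega> in M. X \<omega> = 0" by simp
    show thesis
    proof (rule that)
      show "has_bochner_integral M X 0"
        using ** by (intro has_bochner_integralI_AE[OF has_bochner_integral_zero]) auto
      show "has_bochner_integral M (\<lambda>\<omega>. (X \<omega>)\<^sup>2) 0"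
        using ** by (intro has_bochner_integralI_AE[OF has_bochner_integral_zero]) auto
      show "has_bochner_integral M (\<lambda>\<omega>. (X \<omega>) ^ 4) (3 * 0\<^sup>2)"
        using ** by (simp, intro has_bochner_integralI_AE[OF has_bochner_integral_zero]) auto
    qed
  qed
qed

text \<open>The pair counts as jointly Gaussian through its two combinations \<open>X + Y\<close> and \<open>X - Y\<close> only;
  polarising the fourth moment along them is enough.\<close>

lemma (in prob_space) isserlis_squares:
  assumes XY: "\<And>Z. Z \<in> {X, Y, \<lambda>\<omega>. X \<omega> + Y \<omega>, \<lambda>\<omega>. X \<omega> - Y \<omega>} \<Longrightarrow> gaussian_rv Z"
    and EX: "expectation X = 0" and EY: "expectation Y = 0"
  shows "has_bochner_integral M (\<lambda>\<omega>. X \<omega> * Y \<omega>) (expectation (\<lambda>\<omega>. X \<omega> * Y \<omega>))"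
    and "has_bochner_integral M (\<lambda>\<omega>. (X \<omega>)\<^sup>2 * (Y \<omega>)\<^sup>2)
      (expectation (\<lambda>\<omega>. (X \<omega>)\<^sup>2) * expectation (\<lambda>\<omega>. (Y \<omega>)\<^sup>2) + 2 * (expectation (\<lambda>\<omega>. X \<omega> * Y \<omega>))\<^sup>2)"
proof -
  obtain s where X: "has_bochner_integral M X 0" "has_bochner_integral M (\<lambda>\<omega>. (X \<omega>)\<^sup>2) s"
    "has_bochner_integral M (\<lambda>\<omega>. (X \<omega>) ^ 4) (3 * s\<^sup>2)"
    using gaussian_rv_moments[OF XY EX] by blast
  obtain t where Y: "has_bochner_integral M Y 0" "has_bochner_integral M (\<lambda>\<omega>. (Y \<omega>)\<^sup>2) t"
    "has_bochner_integral M (\<lambda>\<omega>. (Y \<omega>) ^ 4) (3 * t\<^sup>2)"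
    using gaussian_rv_moments[OF XY EY] by blast
  have "expectation (\<lambda>\<omega>. X \<omega> + Y \<omega>) = 0"
    using has_bochner_integral_add[OF X(1) Y(1)] by (auto dest: has_bochner_integral_integral_eq)
  then obtain u where S: "has_bochner_integral M (\<lambda>\<omega>. (X \<omega> + Y \<omega>)\<^sup>2) u"
    "has_bochner_integral M (\<lambda>\<omega>. (X \<omega> + Y \<omega>) ^ 4) (3 * u\<^sup>2)"
    using gaussian_rv_moments[OF XY, of "\<lambda>\<omega>. X \<omega> + Y \<omega>"] by blast
  have "expectation (\<lambda>\<omega>. X \<omega> - Y \<omega>) = 0"
    using has_bochner_integral_diff[OF X(1) Y(1)] by (auto dest: has_bochner_integral_integral_eq)
  then obtain w where D: "has_bochner_integral M (\<lambda>\<omega>. (X \<omega> - Y \<omega>)\<^sup>2) w"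
    "has_bochner_integral M (\<lambda>\<omega>. (X \<omega> - Y \<omega>) ^ 4) (3 * w\<^sup>2)"
    using gaussian_rv_moments[OF XY, of "\<lambda>\<omega>. X \<omega> - Y \<omega>"] by blast
  \<comment> \<open>The covariance, by polarisation of the second moments.\<close>
  define c where "c = (u - s - t) / 2"
  have "has_bochner_integral M (\<lambda>\<omega>. ((X \<omega> + Y \<omega>)\<^sup>2 - (X \<omega>)\<^sup>2 - (Y \<omega>)\<^sup>2) / 2) c"
    unfolding c_def by (intro has_bochner_integral_divide_zero has_bochner_integral_diff S X Y)
  also have "(\<lambda>\<omega>. ((X \<omega> + Y \<omega>)\<^sup>2 - (X \<omega>)\<^sup>2 - (Y \<omega>)\<^sup>2) / 2) = (\<lambda>\<omega>. X \<omega> * Y \<omega>)"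
    by (simp add: power2_eq_square algebra_simps)
  finally have XYc: "has_bochner_integral M (\<lambda>\<omega>. X \<omega> * Y \<omega>) c" .
  then show "has_bochner_integral M (\<lambda>\<omega>. X \<omega> * Y \<omega>) (expectation (\<lambda>\<omega>. X \<omega> * Y \<omega>))"
    by (simp add: has_bochner_integral_iff)
  have "has_bochner_integral M (\<lambda>\<omega>. (X \<omega>)\<^sup>2 + (Y \<omega>)\<^sup>2 - 2 * (X \<omega> * Y \<omega>)) (s + t - 2 * c)"
    by (intro has_bochner_integral_mult_right has_bochner_integral_diff has_bochner_integral_add XYc X Y)
  also have "(\<lambda>\<omega>. (X \<omega>)\<^sup>2 + (Y \<omega>)\<^sup>2 - 2 * (X \<omega> * Y \<omega>)) = (\<lambda>\<omega>. (X \<omega> - Y \<omega>)\<^sup>2)"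
    by (simp add: power2_eq_square algebra_simps)
  finally have w: "w = s + t - 2 * c"
    by (rule has_bochner_integral_eq[OF D(1)])
  have u: "u = s + t + 2 * c"
    by (simp add: c_def field_simps)
  \<comment> \<open>The odd terms cancel in \<open>(x + y) ^ 4 + (x - y) ^ 4 = 2 * x ^ 4 + 12 *
    x\<^sup>2 * y\<^sup>2 + 2 * y ^ 4\<close>.\<close>
  have "has_bochner_integral M
      (\<lambda>\<omega>. ((X \<omega> + Y \<omega>) ^ 4 + (X \<omega> - Y \<omega>) ^ 4 - 2 * (X \<omega>) ^ 4 - 2 * (Y \<omega>) ^ 4) / 12)
      ((3 * u\<^sup>2 + 3 * w\<^sup>2 - 2 * (3 * s\<^sup>2) - 2 * (3 * t\<^sup>2)) / 12)"
    by (intro has_bochner_integral_divide_zero has_bochner_integral_mult_right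
        has_bochner_integral_diff has_bochner_integral_add S D X Y)
  also have "(\<lambda>\<omega>. ((X \<omega> + Y \<omega>) ^ 4 + (X \<omega> - Y \<omega>) ^ 4 - 2 * (X \<omega>) ^ 4 - 2 * (Y \<omega>) ^ 4) / 12) =
      (\<lambda>\<omega>. (X \<omega>)\<^sup>2 * (Y \<omega>)\<^sup>2)"
    by (simp add: power4_eq_xxxx power2_eq_square algebra_simps)
  also have "(3 * u\<^sup>2 + 3 * w\<^sup>2 - 2 * (3 * s\<^sup>2) - 2 * (3 * t\<^sup>2)) / 12 = s * t + 2 * c\<^sup>2"
    unfolding u w by (simp add: power2_eq_square algebra_simps)
  finally show "has_bochner_integral M (\<lambda>\<omega>. (X \<omega>)\<^sup>2 * (Y \<omega>)\<^sup>2)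
      (expectation (\<lambda>\<omega>. (X \<omega>)\<^sup>2) * expectation (\<lambda>\<omega>. (Y \<omega>)\<^sup>2) + 2 * (expectation (\<lambda>\<omega>. X \<omega> * Y \<omega>))\<^sup>2)"
    using X(2) Y(2) XYc by (simp add: has_bochner_integral_iff)
qed

text \<open>These are the variables that \<open>gaussian_process\<close> declares Gaussian. Closure
  properties then cover increments and their sums and differences without explicit
  coefficients.\<close>

definition linear_combination :: "real set \<Rightarrow> (real \<Rightarrow> 'a \<Rightarrow> real) \<Rightarrow> ('a \<Rightarrow> real) \<Rightarrow> bool" where
  "linear_combination I X Z \<longleftrightarrow>
     (\<exists>J c. finite J \<and> J \<subseteq> I \<and> Z = (\<lambda>\<omega>. \<Sum>t\<in>J. c t * X t \<omega>))"

lemma linear_combination_single: "t \<in> I \<Longrightarrow> linear_combination I X (X t)"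
  unfolding linear_combination_def by (intro exI[of _ "{t}"] exI[of _ "\<lambda>_. 1"]) auto

text \<open>Coefficients are extended by 0 to the union of the index sets, where they add. The
  scalar \<open>r\<close> serves sums and differences at once.\<close>

lemma linear_combination_axpy:
  assumes "linear_combination I X Y" "linear_combination I X Z"
  shows "linear_combination I X (\<lambda>\<omega>. Y \<omega> + r * Z \<omega>)"
proof -
  obtain J c where J: "finite J" "J \<subseteq> I" "Y = (\<lambda>\<omega>. \<Sum>t\<in>J. c t * X t \<omega>)"
    using assms unfolding linear_combination_def by blast
  obtain K d where K: "finite K" "K \<subseteq> I" "Z = (\<lambda>\<omega>. \<Sum>t\<in>K. d t * X t \<omega>)"
    using assms unfolding linear_combination_def by blast
  have "(\<Sum>t\<in>J. c t * X t \<omega>) + r * (\<Sum>t\<in>K. d t * X t \<omega>) =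
      (\<Sum>t\<in>J \<union> K. ((if t \<in> J then c t else 0) + (if t \<in> K then r * d t else 0)) * X t \<omega>)" for \<omega>
  proof -
    have "(\<Sum>t\<in>J. c t * X t \<omega>) = (\<Sum>t\<in>J \<union> K. (if t \<in> J then c t else 0) * X t \<omega>)"
      using J K by (intro sum.mono_neutral_cong_left) auto
    moreover have "r * (\<Sum>t\<in>K. d t * X t \<omega>) = (\<Sum>t\<in>J \<union> K. (if t \<in> K then r * d t else 0) * X t \<omega>)"
      unfolding sum_distrib_left using J K by (intro sum.mono_neutral_cong_left) (auto simp: mult.assoc)
    ultimately show ?thesis
      by (simp add: distrib_right sum.distrib)
  qed
  then show ?thesis
    unfolding linear_combination_def using J K by (intro exI[of _ "J \<union> K"] exI conjI ext) auto
qed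

lemma linear_combination_add:
  "linear_combination I X Y \<Longrightarrow> linear_combination I X Z \<Longrightarrow> linear_combination I X (\<lambda>\<omega>. Y \<omega> + Z \<omega>)"
  using linear_combination_axpy[of I X Y Z 1] by simp

lemma linear_combination_diff:
  "linear_combination I X Y \<Longrightarrow> linear_combination I X Z \<Longrightarrow> linear_combination I X (\<lambda>\<omega>. Y \<omega> - Z \<omega>)"
  using linear_combination_axpy[of I X Y Z "-1"] by simp

lemma (in prob_space) gaussian_rv_linear_combination:
  "gaussian_process I X \<Longrightarrow> linear_combination I X Z \<Longrightarrow> gaussian_rv Z"
  by (auto simp: gaussian_process_def linear_combination_def)

lemma (in prob_space) gaussian_process_products:
  assumes X: "gaussian_process I X" and Y: "linear_combination I X Y" and Z: "linear_combination I X Z"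
    and E: "expectation Y = 0" "expectation Z = 0"
  shows "has_bochner_integral M (\<lambda>\<omega>. Y \<omega> * Z \<omega>) (expectation (\<lambda>\<omega>. Y \<omega> * Z \<omega>))"
    and "has_bochner_integral M (\<lambda>\<omega>. (Y \<omega>)\<^sup>2 * (Z \<omega>)\<^sup>2)
      (expectation (\<lambda>\<omega>. (Y \<omega>)\<^sup>2) * expectation (\<lambda>\<omega>. (Z \<omega>)\<^sup>2) + 2 * (expectation (\<lambda>\<omega>. Y \<omega> * Z \<omega>))\<^sup>2)"
  by (rule isserlis_squares; use assms in
      \<open>auto intro!: gaussian_rv_linear_combination[OF X] linear_combination_add linear_combination_diff\<close>)+

section \<open>Increments of fractional Brownian motion\<close>

text \<open>Midpoint convexity at \<open>x + 1\<close> and \<open>x - 1\<close>. The concave case is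
  the convex one with exponent \<open>1/p\<close>, applied to the \<open>p\<close>-th powers of
  these points.\<close>

lemma second_difference_powr:
  fixes p x :: real
  assumes x: "x \<ge> 1"
  shows "1 \<le> p \<Longrightarrow> 2 * x powr p \<le> (x + 1) powr p + (x - 1) powr p"
    and "0 < p \<Longrightarrow> p \<le> 1 \<Longrightarrow> (x + 1) powr p + (x - 1) powr p \<le> 2 * x powr p"
proof -
  \<comment> \<open>The value \<open>v = 0\<close> occurs for \<open>x = 1\<close>; there the claim
    reduces to \<open>2 \<le> 2 powr r\<close>.\<close>
  have mid: "2 * ((u + v) / 2) powr r \<le> u powr r + v powr r" if "0 < u" "0 \<le> v" "1 \<le> r" for u v r :: real
  proof (cases "v = 0")
    case True
    have "2 powr 1 \<le> 2 powr r" using that by (intro powr_mono) auto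
    then have "u powr r * 2 \<le> u powr r * 2 powr r" by (intro mult_left_mono) auto
    with True that show ?thesis by (simp add: powr_divide field_simps)
  next
    case False
    with that have "((1 - 1/2) *\<^sub>R u + (1/2) *\<^sub>R v) powr r \<le> (1 - 1/2) * u powr r + 1/2 * v powr r"
      by (intro convex_onD[OF powr_convex]) auto
    then show ?thesis by (simp add: field_simps)
  qed
  show "2 * x powr p \<le> (x + 1) powr p + (x - 1) powr p" if "1 \<le> p"
    using mid[of "x + 1" "x - 1" p] x that by simp
  show "(x + 1) powr p + (x - 1) powr p \<le> 2 * x powr p" if p: "0 < p" "p \<le> 1"
  proof -
    define u v where "u = (x + 1) powr p" and "v = (x - 1) powr p"
    have "2 * ((u + v) / 2) powr (1/p) \<le> u powr (1/p) + v powr (1/p)"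
      using p x by (intro mid) (auto simp: u_def v_def)
    also have "\<dots> = 2 * x"
      using p x by (simp add: u_def v_def powr_powr)
    finally have "(((u + v) / 2) powr (1/p)) powr p \<le> x powr p"
      using p by (intro powr_mono2) auto
    then show ?thesis
      using p x by (simp add: powr_powr u_def v_def)
  qed
qed

lemma grid_point_in_interval:
  fixes T :: real
  assumes "0 < T" "i \<le> n"
  shows "T * real i / real n \<in> {0..T}"
proof (cases "n = 0")
  case False
  then show ?thesis using assms by (auto simp: field_simps intro!: mult_left_mono)
qed (use assms in simp)

lemma increment_eq:
  "increment T X n i \<omega> = X (T * real (Suc i) / real n) \<omega> - X (T * real i / real n) \<omega>"
  by (simp add: increment_def add.commute)

lemma sum_increment:
  assumes "0 < n"
  shows "(\<Sum>i<n. increment T X n i \<omega>) = X T \<omega> - X 0 \<omega>"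
  using sum_lessThan_telescope[of "\<lambda>i. X (T * real i / real n) \<omega>" n] assms by (simp add: increment_eq)

text \<open>For \<open>p = 2 * H\<close> this is the covariance of fractional Gaussian noise with
  unit step.\<close>

definition fgn_covariance :: "real \<Rightarrow> nat \<Rightarrow> nat \<Rightarrow> real" where
  "fgn_covariance p i j =
     (\<bar>real i - real j + 1\<bar> powr p + \<bar>real i - real j - 1\<bar> powr p - 2 * \<bar>real i - real j\<bar> powr p) / 2"

section \<open>Moments of the increments and of the quadratic variation of \<open>B\<close>\<close>

context prob_space
begin

context
  fixes T H :: real and B :: "real \<Rightarrow> 'a \<Rightarrow> real"
  assumes T: "0 < T" and fbm: "fractional_brownian_motion T H B"
begin

lemma hurst_index: "0 < H" "H < 1"
  and gaussian_process_fbm: "gaussian_process {0..T} B"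
  and expectation_fbm: "t \<in> {0..T} \<Longrightarrow> expectation (B t) = 0"
  and covariance_fbm: "s \<in> {0..T} \<Longrightarrow> t \<in> {0..T} \<Longrightarrow> expectation (\<lambda>\<omega>. B t \<omega> * B s \<omega>) =
        1/2 * (t powr (2*H) + s powr (2*H) - \<bar>t - s\<bar> powr (2*H))"
  using fbm by (auto simp: fractional_brownian_motion_def)

lemma has_bochner_integral_fbm: "t \<in> {0..T} \<Longrightarrow> has_bochner_integral M (B t) 0"
  using gaussian_rv_linear_combination[OF gaussian_process_fbm linear_combination_single] expectation_fbm
  by (blast elim: gaussian_rv_moments)

lemma has_bochner_integral_fbm_product: "s \<in> {0..T} \<Longrightarrow> t \<in> {0..T} \<Longrightarrow>
    has_bochner_integral M (\<lambda>\<omega>. B t \<omega> * B s \<omega>)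
      (1/2 * (t powr (2*H) + s powr (2*H) - \<bar>t - s\<bar> powr (2*H)))"
  using gaussian_process_products(1)[OF gaussian_process_fbm linear_combination_single linear_combination_single, of t s]
  by (simp add: expectation_fbm covariance_fbm)

lemma linear_combination_increment:
  "i < n \<Longrightarrow> linear_combination {0..T} X (increment T X n i)"
  unfolding increment_eq[abs_def] using T
  by (intro linear_combination_diff linear_combination_single grid_point_in_interval) auto

text \<open>Expanding the product gives four covariances of \<open>B\<close>, in which the powers of
  single times cancel. Self-similarity then extracts the power of the mesh.\<close>

lemma has_bochner_integral_fbm_increment_product:
  assumes ij: "i < n" "j < n"
  shows "has_bochner_integral M (\<lambda>\<omega>. increment T B n i \<omega> * increment T B n j \<omega>)
    ((T / real n) powr (2 * H) * fgn_covariance (2 * H) i j)"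
proof -
  define t where "t = (\<lambda>i. T * real i / real n)"
  have t: "t k \<in> {0..T}" if "k \<le> n" for k
    using grid_point_in_interval[OF T that] by (simp add: t_def)
  define r where "r = (\<lambda>k l. 1/2 * ((t k) powr (2*H) + (t l) powr (2*H) - \<bar>t k - t l\<bar> powr (2*H)))"
  have "has_bochner_integral M (\<lambda>\<omega>. B (t (Suc i)) \<omega> * B (t (Suc j)) \<omega> - B (t (Suc i)) \<omega> * B (t j) \<omega>
      - B (t i) \<omega> * B (t (Suc j)) \<omega> + B (t i) \<omega> * B (t j) \<omega>)
      (r (Suc i) (Suc j) - r (Suc i) j - r i (Suc j) + r i j)"
    unfolding r_def using ij
    by (intro has_bochner_integral_add has_bochner_integral_diff has_bochner_integral_fbm_product t) auto
  also have "(\<lambda>\<omega>. B (t (Suc i)) \<omega> * B (t (Suc j)) \<omega> - B (t (Suc i)) \<omega> * B (t j) \<omega>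
      - B (t i) \<omega> * B (t (Suc j)) \<omega> + B (t i) \<omega> * B (t j) \<omega>) =
      (\<lambda>\<omega>. increment T B n i \<omega> * increment T B n j \<omega>)"
    by (simp add: increment_eq t_def algebra_simps del: of_nat_Suc)
  also have "r (Suc i) (Suc j) - r (Suc i) j - r i (Suc j) + r i j =
      (\<bar>t (Suc i) - t j\<bar> powr (2*H) + \<bar>t i - t (Suc j)\<bar> powr (2*H)
        - \<bar>t (Suc i) - t (Suc j)\<bar> powr (2*H) - \<bar>t i - t j\<bar> powr (2*H)) / 2"
    by (simp add: r_def field_simps)
  also have "\<dots> = (T / real n) powr (2 * H) * fgn_covariance (2 * H) i j"
  proof -
    have "\<bar>t k - t l\<bar> powr (2*H) = (T / real n) powr (2 * H) * \<bar>real k - real l\<bar> powr (2*H)" for k l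
    proof -
      have *: "\<bar>t k - t l\<bar> = T / real n * \<bar>real k - real l\<bar>"
        using T by (simp add: t_def flip: abs_mult_pos' right_diff_distrib diff_divide_distrib)
      show ?thesis
        unfolding * by (rule powr_mult)
    qed
    then show ?thesis
      by (simp add: fgn_covariance_def algebra_simps)
  qed
  finally show ?thesis .
qed

lemma has_bochner_integral_fbm_increment_square:
  assumes "i < n"
  shows "has_bochner_integral M (\<lambda>\<omega>. (increment T B n i \<omega>)\<^sup>2) ((T / real n) powr (2 * H))"
  using has_bochner_integral_fbm_increment_product[OF assms assms]
  by (simp add: fgn_covariance_def power2_eq_square)

lemma expectation_fbm_increment:
  assumes "i < n"
  shows "expectation (increment T B n i) = 0"
proof -
  have "has_bochner_integral M (\<lambda>\<omega>. B (T * real (Suc i) / real n) \<omega> - B (T * real i / real n) \<omega>) (0 - 0)"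
    using assms T by (intro has_bochner_integral_diff has_bochner_integral_fbm grid_point_in_interval) auto
  then show ?thesis
    unfolding increment_eq[abs_def] using has_bochner_integral_integral_eq by fastforce
qed

lemma has_bochner_integral_fbm_quadratic_variation:
  "has_bochner_integral M (quadratic_variation T B n) (real n * (T / real n) powr (2 * H))"
proof -
  have "has_bochner_integral M (\<lambda>\<omega>. \<Sum>i<n. (increment T B n i \<omega>)\<^sup>2) (\<Sum>i<n. (T / real n) powr (2 * H))"
    by (intro has_bochner_integral_sum has_bochner_integral_fbm_increment_square) auto
  then show ?thesis
    by (simp add: quadratic_variation_def[abs_def])
qed

text \<open>By the fourth moment formula, two centred squares have as covariance twice the squared
  covariance of the increments.\<close>

lemma has_bochner_integral_fbm_quadratic_variation_variance:
  "has_bochner_integral M (\<lambda>\<omega>. (quadratic_variation T B n \<omega> - real n * (T / real n) powr (2 * H))\<^sup>2)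
    (\<Sum>i<n. \<Sum>j<n. 2 * ((T / real n) powr (2 * H) * fgn_covariance (2 * H) i j)\<^sup>2)"
proof -
  define h where "h = (T / real n) powr (2 * H)"
  define c where "c = (\<lambda>i j. h * fgn_covariance (2 * H) i j)"
  let ?X = "\<lambda>i. increment T B n i"
  have "has_bochner_integral M (\<lambda>\<omega>. (\<Sum>i<n. (?X i \<omega>)\<^sup>2 - h)\<^sup>2) (\<Sum>i<n. \<Sum>j<n. 2 * (c i j)\<^sup>2)"
  proof (rule has_bochner_integral_square_sum)
    fix i j assume "i \<in> {..<n}" "j \<in> {..<n}"
    then have ij: "i < n" "j < n" by auto
    note sq = has_bochner_integral_fbm_increment_square[where n = n, folded h_def]
    have fourth: "has_bochner_integral M (\<lambda>\<omega>. (?X i \<omega>)\<^sup>2 * (?X j \<omega>)\<^sup>2) (h * h + 2 * (c i j)\<^sup>2)"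
      using gaussian_process_products(2)[OF gaussian_process_fbm linear_combination_increment linear_combination_increment
          expectation_fbm_increment expectation_fbm_increment, OF ij ij]
      by (simp add: has_bochner_integral_integral_eq[OF sq] ij c_def h_def
          has_bochner_integral_integral_eq[OF has_bochner_integral_fbm_increment_product])
    have const: "has_bochner_integral M (\<lambda>_. h * h) (h * h)"
      by (simp add: has_bochner_integral_iff prob_space)
    \<comment> \<open>In the expansion of \<open>(x\<^sup>2 - h) * (y\<^sup>2 - h)\<close> the last
      three terms integrate to \<open>- h * h\<close>, which cancels the product of the
      variances.\<close>
    from has_bochner_integral_add[OF has_bochner_integral_diff[OF has_bochner_integral_diff[OF fourth
          has_bochner_integral_mult_right[OF sq[OF ij(1)], of h]]
          has_bochner_integral_mult_right[OF sq[OF ij(2)], of h]] const]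
    show "has_bochner_integral M (\<lambda>\<omega>. ((?X i \<omega>)\<^sup>2 - h) * ((?X j \<omega>)\<^sup>2 - h)) (2 * (c i j)\<^sup>2)"
      by (simp add: algebra_simps)
  qed
  then show ?thesis
    by (simp add: quadratic_variation_def sum_subtractf h_def c_def)
qed

text \<open>Both sides are the second moment of \<open>B T - B 0\<close>, expanded over
  \<open>n\<close> increments or read off from the grid with a single one.\<close>

lemma sum_fgn_covariance:
  assumes n: "0 < n"
  shows "(\<Sum>i<n. \<Sum>j<n. (T / real n) powr (2 * H) * fgn_covariance (2 * H) i j) = T powr (2 * H)"
proof -
  have "has_bochner_integral M (\<lambda>\<omega>. (\<Sum>i<n. increment T B n i \<omega>)\<^sup>2)
      (\<Sum>i<n. \<Sum>j<n. (T / real n) powr (2 * H) * fgn_covariance (2 * H) i j)"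
    by (intro has_bochner_integral_square_sum has_bochner_integral_fbm_increment_product) auto
  moreover have "has_bochner_integral M (\<lambda>\<omega>. (\<Sum>i<n. increment T B n i \<omega>)\<^sup>2) (T powr (2 * H))"
    using has_bochner_integral_fbm_increment_square[of 0 1]
    by (simp add: sum_increment n) (simp add: increment_def)
  ultimately show ?thesis
    by (rule has_bochner_integral_eq)
qed

text \<open>Cauchy-Schwarz for two increments of equal variance, from the nonnegative second moments
  of their sum and difference.\<close>

lemma abs_fgn_covariance_le_1: "\<bar>fgn_covariance (2 * H) i j\<bar> \<le> 1"
proof -
  \<comment> \<open>Any grid containing both indices serves, since \<open>fgn_covariance\<close> is
    independent of the mesh.\<close>
  define n where "n = Suc (max i j)"
  define h where "h = (T / real n) powr (2 * H)"
  have h: "0 < h" using T by (simp add: h_def n_def)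
  have ij: "i < n" "j < n" by (auto simp: n_def)
  let ?X = "\<lambda>i. increment T B n i"
  note sq = has_bochner_integral_fbm_increment_square[where n = n, folded h_def]
    and pr = has_bochner_integral_fbm_increment_product[OF ij, folded h_def]
  have *: "0 \<le> h + h + 2 * r * (h * fgn_covariance (2 * H) i j)" if "r\<^sup>2 = 1" for r :: real
  proof -
    have "has_bochner_integral M (\<lambda>\<omega>. (?X i \<omega>)\<^sup>2 + (?X j \<omega>)\<^sup>2 + 2 * r * (?X i \<omega> * ?X j \<omega>))
        (h + h + 2 * r * (h * fgn_covariance (2 * H) i j))"
      by (intro has_bochner_integral_add has_bochner_integral_mult_right sq pr ij)
    also have "(\<lambda>\<omega>. (?X i \<omega>)\<^sup>2 + (?X j \<omega>)\<^sup>2 + 2 * r * (?X i \<omega> * ?X j \<omega>)) = (\<lambda>\<omega>. (?X i \<omega> + r * ?X j \<omega>)\<^sup>2)"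
      using that by (simp add: power2_sum power_mult_distrib mult_ac)
    finally have *: "has_bochner_integral M (\<lambda>\<omega>. (?X i \<omega> + r * ?X j \<omega>)\<^sup>2)
        (h + h + 2 * r * (h * fgn_covariance (2 * H) i j))" .
    show ?thesis
      unfolding has_bochner_integral_integral_eq[OF *, symmetric] by simp
  qed
  have "0 \<le> h * (1 + fgn_covariance (2 * H) i j)" "0 \<le> h * (1 - fgn_covariance (2 * H) i j)"
    using *[of 1] *[of "-1"] by (auto simp: algebra_simps)
  with h show ?thesis
    by (auto simp: zero_le_mult_iff)
qed


text \<open>Off the diagonal the covariance is half a second difference of the power function, taken
  at a distance of at least 1.\<close>

lemma fgn_covariance_same_sign:
  assumes "i \<noteq> j"
  shows "1/2 \<le> H \<Longrightarrow> 0 \<le> fgn_covariance (2 * H) i j"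
    and "H \<le> 1/2 \<Longrightarrow> fgn_covariance (2 * H) i j \<le> 0"
proof -
  define x where "x = \<bar>real i - real j\<bar>"
  have x: "1 \<le> x" using assms by (auto simp: x_def)
  have "\<bar>real i - real j + 1\<bar> powr (2 * H) + \<bar>real i - real j - 1\<bar> powr (2 * H) =
      (x + 1) powr (2 * H) + (x - 1) powr (2 * H)"
  proof (cases "i < j")
    case True
    then have "\<bar>real i - real j + 1\<bar> = x - 1" "\<bar>real i - real j - 1\<bar> = x + 1"
      by (auto simp: x_def)
    then show ?thesis by simp
  next
    case False
    with assms have "\<bar>real i - real j + 1\<bar> = x + 1" "\<bar>real i - real j - 1\<bar> = x - 1"
      by (auto simp: x_def)
    then show ?thesis by simp
  qed
  then have *: "fgn_covariance (2 * H) i j =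
      ((x + 1) powr (2 * H) + (x - 1) powr (2 * H) - 2 * x powr (2 * H)) / 2"
    by (simp add: fgn_covariance_def x_def)
  show "1/2 \<le> H \<Longrightarrow> 0 \<le> fgn_covariance (2 * H) i j"
    using second_difference_powr(1)[OF x, of "2 * H"] by (simp add: *)
  show "H \<le> 1/2 \<Longrightarrow> fgn_covariance (2 * H) i j \<le> 0"
    using second_difference_powr(2)[OF x, of "2 * H"] hurst_index by (simp add: *)
qed

text \<open>Covariances of modulus at most 1 have squares dominated by their moduli. Owing to the
  constant sign off the diagonal, the sum of the moduli follows from the total
  \<open>T powr (2 * H)\<close> and the diagonal.\<close>

lemma sum_fgn_covariance_square_le:
  assumes n: "0 < n"
  defines "h \<equiv> (T / real n) powr (2 * H)"
  shows "1/2 \<le> H \<Longrightarrow>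
      (\<Sum>i<n. \<Sum>j<n. (h * fgn_covariance (2 * H) i j)\<^sup>2) \<le> h * T powr (2 * H)"
    and "H \<le> 1/2 \<Longrightarrow>
      (\<Sum>i<n. \<Sum>j<n. (h * fgn_covariance (2 * H) i j)\<^sup>2) \<le> 2 * real n * h\<^sup>2"
proof -
  let ?c = "\<lambda>i j. fgn_covariance (2 * H) i j"
  have h: "0 \<le> h" by (simp add: h_def)
  have sum: "(\<Sum>i<n. \<Sum>j<n. h * ?c i j) = T powr (2 * H)"
    using sum_fgn_covariance[OF n] by (simp add: h_def)
  have diag: "?c i i = 1" for i
    by (simp add: fgn_covariance_def)
  have "(h * ?c i j)\<^sup>2 = h * (h * (?c i j)\<^sup>2)" for i j
    by (simp add: power_mult_distrib power2_eq_square)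
  moreover have "(?c i j)\<^sup>2 \<le> \<bar>?c i j\<bar>" for i j
    using mult_left_le[OF abs_fgn_covariance_le_1[of i j] abs_ge_zero[of "?c i j"]]
    by (simp add: power2_eq_square flip: abs_mult)
  ultimately have le: "(h * ?c i j)\<^sup>2 \<le> h * (h * \<bar>?c i j\<bar>)" for i j
    using h by (metis mult_left_mono)
  show "(\<Sum>i<n. \<Sum>j<n. (h * ?c i j)\<^sup>2) \<le> h * T powr (2 * H)" if "1/2 \<le> H"
  proof -
    have "\<bar>?c i j\<bar> = ?c i j" for i j
      using fgn_covariance_same_sign(1)[of i j] that diag by (cases "i = j") auto
    then have "(\<Sum>i<n. \<Sum>j<n. (h * ?c i j)\<^sup>2) \<le> (\<Sum>i<n. \<Sum>j<n. h * (h * ?c i j))"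
      using le by (intro sum_mono) metis
    also have "\<dots> = h * (\<Sum>i<n. \<Sum>j<n. h * ?c i j)"
      by (simp only: sum_distrib_left)
    also have "\<dots> = h * T powr (2 * H)"
      by (simp only: sum)
    finally show ?thesis .
  qed
  show "(\<Sum>i<n. \<Sum>j<n. (h * ?c i j)\<^sup>2) \<le> 2 * real n * h\<^sup>2" if "H \<le> 1/2"
  proof -
    \<comment> \<open>Off the diagonal the modulus is minus the covariance; on it, where the
      covariance is 1, the term \<open>2 * h\<close> corrects the sign.\<close>
    have "h * \<bar>?c i j\<bar> = (if i = j then 2 * h else 0) - h * ?c i j" for i j
      using fgn_covariance_same_sign(2)[of i j] that diag by (cases "i = j") auto
    then have "(\<Sum>i<n. \<Sum>j<n. (h * ?c i j)\<^sup>2) \<le> (\<Sum>i<n. \<Sum>j<n. h * ((if i = j then 2 * h else 0) - h * ?c i j))"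
      using le by (intro sum_mono) metis
    also have "\<dots> = h * (\<Sum>i<n. \<Sum>j<n. (if i = j then 2 * h else 0) - h * ?c i j)"
      by (simp only: sum_distrib_left)
    also have "\<dots> = h * (real n * (2 * h) - T powr (2 * H))"
      by (simp only: sum_subtractf sum) simp
    also have "\<dots> \<le> h * (real n * (2 * h))"
      using h by (intro mult_left_mono) auto
    finally show ?thesis
      by (simp add: power2_eq_square mult_ac)
  qed
qed

section \<open>Almost sure behaviour of the quadratic variation of \<open>B\<close> on dyadic
  grids\<close>

lemma fbm_scaling_dyadic: "(T / real (2 ^ k)) powr (2 * H) = T powr (2 * H) * (2 powr (- 2 * H)) ^ k"
proof -
  have "T / real (2 ^ k) = T * 2 powr (- real k)"
    by (simp add: powr_minus powr_realpow divide_inverse)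
  then show ?thesis
    by (simp only: powr_mult powr_powr powr_power) (simp add: powr_power mult_ac)
qed

lemma fbm_quadratic_variation_mean_dyadic:
  "real (2 ^ k) * (T / real (2 ^ k)) powr (2 * H) = T powr (2 * H) * (2 powr (1 - 2 * H)) ^ k"
  unfolding fbm_scaling_dyadic by (simp add: powr_diff powr_minus power_divide divide_inverse power_mult_distrib power_inverse)

text \<open>The second moments decay at rate \<open>2 powr (- 2 * H)\<close> for
  \<open>H \<ge> 1/2\<close> and \<open>2 powr (1 - 4 * H)\<close> for \<open>H < 1/2\<close>. Both
  rates are below \<open>2 powr (2 - 4 * H)\<close>, the former because
  \<open>H < 1\<close>.\<close>

lemma AE_fbm_quadratic_variation_error:
  "AE \<omega> in M. (\<lambda>k. real k * (quadratic_variation T B (2 ^ k) \<omega> - T powr (2 * H) * (2 powr (1 - 2 * H)) ^ k)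
      / (2 powr (1 - 2 * H)) ^ k) \<longlonglongrightarrow> 0"
proof -
  define S where "S = (\<lambda>k. \<Sum>i<2^k. \<Sum>j<2^k. ((T / real (2^k)) powr (2 * H) * fgn_covariance (2 * H) i j)\<^sup>2)"
  have HB: "has_bochner_integral M (\<lambda>\<omega>. (quadratic_variation T B (2 ^ k) \<omega> - T powr (2 * H) * (2 powr (1 - 2 * H)) ^ k)\<^sup>2)
      (2 * S k)" for k
    using has_bochner_integral_fbm_quadratic_variation_variance[of "2 ^ k"]
    unfolding fbm_quadratic_variation_mean_dyadic by (simp add: S_def sum_distrib_left)
  have q: "(2 powr (1 - 2 * H))\<^sup>2 = 2 powr (2 - 4 * H)"
    by (simp add: powr_power)
  show ?thesis
  proof (cases "1/2 \<le> H")
    case True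
    have "2 * S k \<le> 2 * (T powr (2 * H))\<^sup>2 * (2 powr (- 2 * H)) ^ k" for k
      using sum_fgn_covariance_square_le(1)[of "2 ^ k"] True
      unfolding fbm_scaling_dyadic S_def by (simp add: power2_eq_square mult_ac)
    from AE_tendsto_0_if_second_moment_decay[OF HB this] show ?thesis
      using hurst_index by (simp add: q)
  next
    case False
    have "2 * S k \<le> 4 * (T powr (2 * H))\<^sup>2 * (2 powr (1 - 4 * H)) ^ k" for k
    proof -
      have "2 * S k \<le> 4 * real (2 ^ k) * ((T / real (2^k)) powr (2 * H))\<^sup>2"
        using sum_fgn_covariance_square_le(2)[of "2 ^ k"] False unfolding S_def by simp
      also have "\<dots> = 4 * (T powr (2 * H))\<^sup>2 * (2 * (2 powr (- 2 * H))\<^sup>2) ^ k"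
        unfolding fbm_scaling_dyadic by (simp add: power_mult_distrib power2_eq_square)
      also have "2 * (2 powr (- 2 * H))\<^sup>2 = 2 powr (1 - 4 * H)"
        using powr_add[of 2 1 "- 4 * H"] by (simp add: powr_power)
      finally show ?thesis .
    qed
    from AE_tendsto_0_if_second_moment_decay[OF HB this] show ?thesis
      by (simp add: q)
  qed
qed

text \<open>For nonnegative variables the means suffice, and these form a geometric sequence of
  ratio below 1.\<close>

lemma AE_fbm_quadratic_variation_tendsto_0:
  assumes "1/2 < H"
  shows "AE \<omega> in M. (\<lambda>k. quadratic_variation T B (2 ^ k) \<omega>) \<longlonglongrightarrow> 0"
proof (rule AE_tendsto_0_if_summable_expectation)
  show "has_bochner_integral M (quadratic_variation T B (2 ^ k)) (T powr (2 * H) * (2 powr (1 - 2 * H)) ^ k)" for k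
    using has_bochner_integral_fbm_quadratic_variation[of "2 ^ k"]
    unfolding fbm_quadratic_variation_mean_dyadic .
  have "2 powr (1 - 2 * H) < 2 powr 0"
    using assms by (intro powr_less_mono) auto
  then show "summable (\<lambda>k. T powr (2 * H) * (2 powr (1 - 2 * H)) ^ k)"
    by (intro summable_mult summable_geometric) simp
qed (simp add: quadratic_variation_def sum_nonneg)

end

section \<open>Increments of the Wiener process and the cross term\<close>

context
  fixes T :: real and W :: "real \<Rightarrow> 'a \<Rightarrow> real"
  assumes T: "0 < T" and W: "wiener_process T W"
begin

lemma distributed_wiener_increment:
  assumes "i < n"
  shows "distributed M lborel (increment T W n i) (normal_density 0 (sqrt (T / real n)))"
proof -
  have "T * real (Suc i) / real n - T * real i / real n = T / real n"
    by (simp add: algebra_simps flip: diff_divide_distrib)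
  moreover have "0 \<le> T * real i / real n" "T * real i / real n < T * real (Suc i) / real n"
    using T assms by (auto simp: field_simps)
  moreover have "T * real (Suc i) / real n \<le> T"
    using grid_point_in_interval[OF T, of "Suc i" n] assms by auto
  ultimately show ?thesis
    using W unfolding wiener_process_def increment_eq[abs_def] by metis
qed

lemma wiener_increment_moments:
  assumes "i < n"
  shows "has_bochner_integral M (increment T W n i) 0"
    and "has_bochner_integral M (\<lambda>\<omega>. (increment T W n i \<omega>)\<^sup>2) (T / real n)"
    and "has_bochner_integral M (\<lambda>\<omega>. (increment T W n i \<omega>) ^ 4) (3 * (T / real n)\<^sup>2)"
  using has_bochner_integral_normal_moments[OF distributed_wiener_increment[OF assms]] T assms by auto

lemma indep_vars_wiener_increments: "indep_vars (\<lambda>_. borel) (increment T W n) {..<n}"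
proof (cases "n = 0")
  case False
  define t where "t = (\<lambda>i. T * real i / real n)"
  have "strict_mono_on {..n} t"
    using T False by (auto simp: strict_mono_on_def t_def divide_strict_right_mono)
  moreover have "t ` {..n} \<subseteq> {0..T}"
    using grid_point_in_interval[OF T] by (auto simp: t_def simp del: atLeastAtMost_iff)
  ultimately have "indep_vars (\<lambda>_. borel) (\<lambda>i \<omega>. W (t (Suc i)) \<omega> - W (t i) \<omega>) {..<n}"
    using W unfolding wiener_process_def by blast
  then show ?thesis
    by (simp add: t_def increment_eq[abs_def])
qed (simp add: indep_vars_def indep_sets_def)

lemma indep_var_wiener_increments:
  assumes "i < n" "j < n" "i \<noteq> j"
  shows "indep_var borel (increment T W n i) borel (increment T W n j)"
proof -
  have "indep_vars (\<lambda>_. borel) (increment T W n) (insert i {j})"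
    using assms by (intro indep_vars_subset[OF indep_vars_wiener_increments]) auto
  \<comment> \<open>Over the index set \<open>{j}\<close> the sum in \<open>indep_vars_sum\<close>
    has a single term.\<close>
  from indep_vars_sum[OF _ _ this] assms show ?thesis by simp
qed

lemma has_bochner_integral_wiener_increment_product:
  assumes ij: "i < n" "j < n"
  shows "has_bochner_integral M (\<lambda>\<omega>. increment T W n i \<omega> * increment T W n j \<omega>)
    (if i = j then T / real n else 0)"
proof (cases "i = j")
  case True
  then show ?thesis
    using wiener_increment_moments(2)[OF ij(1)] by (simp add: power2_eq_square)
next
  case False
  note m = wiener_increment_moments(1)[unfolded has_bochner_integral_iff]
  show ?thesis
    using indep_var_integrable[OF indep_var_wiener_increments[OF ij False]] m[OF ij(1)] m[OF ij(2)]
      indep_var_lebesgue_integral[OF indep_var_wiener_increments[OF ij False]] False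
    by (simp add: has_bochner_integral_iff)
qed

text \<open>Centred squares of distinct increments are uncorrelated by independence, so only the
  \<open>n\<close> diagonal terms remain.\<close>

lemma has_bochner_integral_wiener_quadratic_variation_variance:
  assumes n: "0 < n"
  shows "has_bochner_integral M (\<lambda>\<omega>. (quadratic_variation T W n \<omega> - T)\<^sup>2) (2 * T\<^sup>2 / real n)"
proof -
  define h where "h = T / real n"
  let ?Y = "\<lambda>i \<omega>. (increment T W n i \<omega>)\<^sup>2 - h"
  have const: "has_bochner_integral M (\<lambda>_. r) r" for r :: real
    by (simp add: has_bochner_integral_iff prob_space)
  have "has_bochner_integral M (\<lambda>\<omega>. (\<Sum>i<n. ?Y i \<omega>)\<^sup>2) (\<Sum>i<n. \<Sum>j<n. if i = j then 2 * h\<^sup>2 else 0)"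
  proof (rule has_bochner_integral_square_sum)
    fix i j assume "i \<in> {..<n}" "j \<in> {..<n}"
    then have ij: "i < n" "j < n" by auto
    note m2 = wiener_increment_moments(2)[where n = n, folded h_def]
    note m4 = wiener_increment_moments(3)[where n = n, folded h_def]
    show "has_bochner_integral M (\<lambda>\<omega>. ?Y i \<omega> * ?Y j \<omega>) (if i = j then 2 * h\<^sup>2 else 0)"
    proof (cases "i = j")
      case True
      have "has_bochner_integral M (\<lambda>\<omega>. (increment T W n i \<omega>) ^ 4 - 2 * h * (increment T W n i \<omega>)\<^sup>2 + h\<^sup>2)
          (3 * h\<^sup>2 - 2 * h * h + h\<^sup>2)"
        by (intro has_bochner_integral_add has_bochner_integral_diff has_bochner_integral_mult_right m2 m4 const ij)
      then show ?thesis
        using True by (simp add: algebra_simps power2_eq_square power4_eq_xxxx)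
    next
      case False
      have ind: "indep_var borel (?Y i) borel (?Y j)"
        using indep_var_compose[OF indep_var_wiener_increments[OF ij False],
            of "\<lambda>x. x\<^sup>2 - h" borel "\<lambda>x. x\<^sup>2 - h" borel] by (simp add: comp_def)
      have Y: "has_bochner_integral M (?Y k) (h - h)" if "k < n" for k
        by (intro has_bochner_integral_diff m2 const that)
      show ?thesis
        using Y[OF ij(1)] Y[OF ij(2)] False indep_var_integrable[OF ind] indep_var_lebesgue_integral[OF ind]
        by (simp add: has_bochner_integral_iff)
    qed
  qed
  moreover have "(\<Sum>i<n. \<Sum>j<n. if i = j then 2 * h\<^sup>2 else 0) = 2 * T\<^sup>2 / real n"
    using n by (simp add: h_def power2_eq_square field_simps)
  moreover have "(\<Sum>i<n. ?Y i \<omega>) = quadratic_variation T W n \<omega> - T" for \<omega>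
    using n by (simp add: quadratic_variation_def sum_subtractf h_def)
  ultimately show ?thesis by simp
qed

text \<open>The variance at level \<open>k\<close> is \<open>2 * T\<^sup>2 * (1/2) ^ k\<close>. For
  \<open>q = 2 powr (1 - 2 * H)\<close> the condition \<open>1/2 < q\<^sup>2\<close> means
  \<open>H < 3/4\<close>.\<close>

lemma AE_wiener_quadratic_variation_error:
  assumes q: "0 < q" "1/2 < q\<^sup>2"
  shows "AE \<omega> in M. (\<lambda>k. real k * (quadratic_variation T W (2 ^ k) \<omega> - T) / q ^ k) \<longlonglongrightarrow> 0"
  using q
  by (intro AE_tendsto_0_if_second_moment_decay[OF has_bochner_integral_wiener_quadratic_variation_variance,
        where C = "2 * T\<^sup>2" and r = "1/2"]) (auto simp: power_one_over divide_simps)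

text \<open>Without rescaling by \<open>q ^ k\<close>, summability of the variances is enough; (ii)
  uses this form, also for \<open>H \<ge> 3/4\<close>.\<close>

lemma AE_wiener_quadratic_variation_tendsto:
  "AE \<omega> in M. (\<lambda>k. quadratic_variation T W (2 ^ k) \<omega>) \<longlonglongrightarrow> T"
proof -
  have "AE \<omega> in M. (\<lambda>k. (quadratic_variation T W (2 ^ k) \<omega> - T)\<^sup>2) \<longlonglongrightarrow> 0"
  proof (rule AE_tendsto_0_if_summable_expectation)
    show "has_bochner_integral M (\<lambda>\<omega>. (quadratic_variation T W (2 ^ k) \<omega> - T)\<^sup>2) (2 * T\<^sup>2 * (1/2) ^ k)" for k
      using has_bochner_integral_wiener_quadratic_variation_variance[of "2 ^ k"]
      by (simp add: power_one_over)
    show "summable (\<lambda>k. 2 * T\<^sup>2 * (1/2::real) ^ k)"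
      by (intro summable_mult summable_geometric) simp
  qed simp
  then show ?thesis
    by eventually_elim (simp add: LIM_zero_iff)
qed

text \<open>By independence the mixed moments factor into covariances of \<open>B\<close> and of
  \<open>W\<close>, and the latter vanish off the diagonal. The remaining rate
  \<open>2 powr (- 2 * H)\<close> is below \<open>2 powr (2 - 4 * H)\<close> because
  \<open>H < 1\<close>.\<close>

lemma AE_cross_variation_error:
  assumes fbm: "fractional_brownian_motion T H B" and ind: "indep_processes {0..T} B W"
  shows "AE \<omega> in M. (\<lambda>k. real k * (\<Sum>i<2^k. increment T B (2^k) i \<omega> * increment T W (2^k) i \<omega>)
      / (2 powr (1 - 2 * H)) ^ k) \<longlonglongrightarrow> 0"
proof -
  have HB: "has_bochner_integral M (\<lambda>\<omega>. (\<Sum>i<n. increment T B n i \<omega> * increment T W n i \<omega>)\<^sup>2)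
      (T * (T / real n) powr (2 * H))" if n: "0 < n" for n
  proof -
    have "has_bochner_integral M (\<lambda>\<omega>. (\<Sum>i<n. increment T B n i \<omega> * increment T W n i \<omega>)\<^sup>2)
      (\<Sum>i<n. \<Sum>j<n. (T / real n) powr (2 * H) * fgn_covariance (2 * H) i j * (if i = j then T / real n else 0))"
    proof (rule has_bochner_integral_square_sum)
      fix i j assume "i \<in> {..<n}" "j \<in> {..<n}"
      then have ij: "i < n" "j < n" by auto
      define t where "t = (\<lambda>i. T * real i / real n)"
      have t: "t k \<in> {0..T}" if "k \<le> n" for k
        using grid_point_in_interval[OF T that] by (simp add: t_def)
      have t': "t i \<in> {0..T}" "t (Suc i) \<in> {0..T}" "t j \<in> {0..T}" "t (Suc j) \<in> {0..T}"
        using ij by (auto intro!: t simp del: atLeastAtMost_iff)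
      \<comment> \<open>The product of two increments as a function of the path. It reads only four
        times, hence is measurable, and carries independence of the processes over to these
        products.\<close>
      define f where "f = (\<lambda>x::real \<Rightarrow> real. (x (t (Suc i)) - x (t i)) * (x (t (Suc j)) - x (t j)))"
      have f: "f \<in> borel_measurable (Pi\<^sub>M {0..T} (\<lambda>_. borel))"
        unfolding f_def using t'
        by (intro borel_measurable_times borel_measurable_diff measurable_component_singleton)
      have fX: "f \<circ> (\<lambda>\<omega>. \<lambda>t\<in>{0..T}. X t \<omega>) = (\<lambda>\<omega>. increment T X n i \<omega> * increment T X n j \<omega>)"
        for X :: "real \<Rightarrow> 'a \<Rightarrow> real"
        using t' by (auto simp: f_def increment_eq t_def fun_eq_iff simp del: of_nat_Suc)
      have ind': "indep_var borel (\<lambda>\<omega>. increment T B n i \<omega> * increment T B n j \<omega>)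
          borel (\<lambda>\<omega>. increment T W n i \<omega> * increment T W n j \<omega>)"
        using indep_var_compose[OF ind[unfolded indep_processes_def] f f] unfolding fX .
      have "has_bochner_integral M (\<lambda>\<omega>. (increment T B n i \<omega> * increment T B n j \<omega>) *
          (increment T W n i \<omega> * increment T W n j \<omega>))
          ((T / real n) powr (2 * H) * fgn_covariance (2 * H) i j * (if i = j then T / real n else 0))"
        using indep_var_integrable[OF ind'] indep_var_lebesgue_integral[OF ind']
          has_bochner_integral_fbm_increment_product[OF T fbm ij]
          has_bochner_integral_wiener_increment_product[OF ij]
        by (simp add: has_bochner_integral_iff)
      then show "has_bochner_integral M (\<lambda>\<omega>. (increment T B n i \<omega> * increment T W n i \<omega>) *
          (increment T B n j \<omega> * increment T W n j \<omega>))
          ((T / real n) powr (2 * H) * fgn_covariance (2 * H) i j * (if i = j then T / real n else 0))"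
        by (simp add: mult_ac)
    qed
    also have "(\<Sum>i<n. \<Sum>j<n. (T / real n) powr (2 * H) * fgn_covariance (2 * H) i j *
        (if i = j then T / real n else 0)) = T * (T / real n) powr (2 * H)"
      using n by (simp add: fgn_covariance_def if_distrib[where f = "\<lambda>x. _ * x"] cong: if_cong)
    finally show ?thesis .
  qed
  have "(2 powr (1 - 2 * H))\<^sup>2 = 2 powr (2 - 4 * H)"
    by (simp add: powr_power)
  then show ?thesis
    using hurst_index[OF T fbm]
    by (intro AE_tendsto_0_if_second_moment_decay[OF HB, where C = "T * T powr (2 * H)" and r = "2 powr (- 2 * H)"])
      (auto simp: fbm_scaling_dyadic[OF T fbm, simplified])
qed

end

end

section \<open>Consistency of the estimators\<close>

text \<open>The estimator contains the factor \<open>2 powr (k * (2 * h k - 1))\<close>, so consistency of \<open>h k\<close>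
  does not suffice: the relative error of \<open>u k\<close> has to be \<open>o(1/k)\<close>.\<close>

lemma plug_in_estimator_tendsto:
  fixes u h :: "nat \<Rightarrow> real" and c p T :: real
  assumes c: "c \<noteq> 0" and p: "p \<noteq> 1" and T: "T > 0"
    and u: "(\<lambda>k. real k * (u k / (c * (2 powr (1 - p)) ^ k) - 1)) \<longlonglongrightarrow> 0"
    and h: "\<And>k. h k = 1/2 * (log2_plus (u k / u (k + 1)) + 1)"
  shows "(\<lambda>k. 2 powr (real k * (2 * h k - 1)) * T powr (- 2 * h k) *
      inverse (1 - 2 powr (1 - 2 * h k)) * u k) \<longlonglongrightarrow> c * T powr (- p) / (1 - 2 powr (1 - p))"
proof -
  define q where "q = 2 powr (1 - p)"
  define e where "e = (\<lambda>k. u k / (c * q ^ k))"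
  \<comment> \<open>\<open>L k\<close> is the error of the plug-in exponent: eventually
    \<open>2 * h k = p + L k\<close>.\<close>
  define L where "L = (\<lambda>k. log 2 (e k) - log 2 (e (Suc k)))"
  have q: "0 < q" "q \<noteq> 1"
    using p by (auto simp: q_def)
  have u_eq: "u k = c * q ^ k * e k" for k
    using c q by (simp add: e_def)
  have ke: "(\<lambda>k. real k * (e k - 1)) \<longlonglongrightarrow> 0"
    using u by (simp add: e_def q_def)
  have "(\<lambda>k. 1 + inverse (real k) * (real k * (e k - 1))) \<longlonglongrightarrow> 1 + 0 * 0"
    by (intro tendsto_intros ke lim_inverse_n)
  moreover have "\<forall>\<^sub>F k in sequentially. 1 + inverse (real k) * (real k * (e k - 1)) = e k"
    using eventually_gt_at_top[of 0] by eventually_elim (simp add: field_simps)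
  ultimately have e: "e \<longlonglongrightarrow> 1"
    by (simp add: filterlim_cong)
  then have e': "(\<lambda>k. e (Suc k)) \<longlonglongrightarrow> 1"
    by (rule LIMSEQ_Suc)
  have e_pos: "\<forall>\<^sub>F k in sequentially. 0 < e k"
    using e by (rule order_tendstoD) simp
  \<comment> \<open>The logarithm is squeezed between \<open>(e k - 1) / e k\<close> and
    \<open>e k - 1\<close>, both of which are \<open>o(1/k)\<close>.\<close>
  have "(\<lambda>k. real k * ln (e k)) \<longlonglongrightarrow> 0"
  proof (rule tendsto_sandwich)
    show "\<forall>\<^sub>F k in sequentially. real k * (e k - 1) / e k \<le> real k * ln (e k)"
      using e_pos
    proof eventually_elim
      case (elim k)
      have "- ln (e k) \<le> inverse (e k) - 1"
        using elim ln_le_minus_one[of "inverse (e k)"] by (simp add: ln_inverse)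
      then have "(e k - 1) / e k \<le> ln (e k)"
        using elim by (simp add: field_simps)
      then show ?case
        using mult_left_mono[of "(e k - 1) / e k" "ln (e k)" "real k"] by simp
    qed
    show "\<forall>\<^sub>F k in sequentially. real k * ln (e k) \<le> real k * (e k - 1)"
      using e_pos by eventually_elim (intro mult_left_mono ln_le_minus_one, auto)
    show "(\<lambda>k. real k * (e k - 1) / e k) \<longlonglongrightarrow> 0"
      using tendsto_divide[OF ke e] by simp
  qed (rule ke)
  then have klog: "(\<lambda>k. real k * log 2 (e k)) \<longlonglongrightarrow> 0"
    using tendsto_divide[OF _ tendsto_const, of "\<lambda>k. real k * ln (e k)" 0 sequentially "ln 2"]
    by (simp add: log_def)
  \<comment> \<open>Shifting the index changes the weight to \<open>Suc k\<close>; the surplus copy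
    tends to 0.\<close>
  have "(\<lambda>k. real (Suc k) * log 2 (e (Suc k)) - log 2 (e (Suc k))) \<longlonglongrightarrow> 0 - log 2 1"
    using e' by (intro tendsto_intros LIMSEQ_Suc[OF klog]) auto
  then have klog': "(\<lambda>k. real k * log 2 (e (Suc k))) \<longlonglongrightarrow> 0"
    by (simp add: algebra_simps)
  have kL: "(\<lambda>k. real k * L k) \<longlonglongrightarrow> 0"
    using tendsto_diff[OF klog klog'] by (simp add: L_def algebra_simps)
  have "L \<longlonglongrightarrow> log 2 1 - log 2 1"
    unfolding L_def by (intro tendsto_intros e e') auto
  then have L: "L \<longlonglongrightarrow> 0" by simp
  \<comment> \<open>In terms of \<open>L\<close> and \<open>e\<close> the estimator is a continuous
    expression, apart from the growing factor \<open>k\<close> in an exponent, which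
    \<open>kL\<close> controls.\<close>
  have "(\<lambda>k. c * (2 powr (real k * L k) * T powr (- (p + L k)) *
      inverse (1 - 2 powr (1 - p - L k)) * e k)) \<longlonglongrightarrow>
      c * (2 powr 0 * T powr (- (p + 0)) * inverse (1 - 2 powr (1 - p - 0)) * 1)"
    using q T by (intro tendsto_intros kL L e) (auto simp: q_def)
  then have lim: "(\<lambda>k. c * (2 powr (real k * L k) * T powr (- (p + L k)) *
      inverse (1 - 2 powr (1 - p - L k)) * e k)) \<longlonglongrightarrow> c * T powr (- p) / (1 - 2 powr (1 - p))"
    by (simp add: divide_inverse mult.assoc)
  have "\<forall>\<^sub>F k in sequentially. 2 powr (real k * (2 * h k - 1)) * T powr (- 2 * h k) *
      inverse (1 - 2 powr (1 - 2 * h k)) * u k =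
    c * (2 powr (real k * L k) * T powr (- (p + L k)) * inverse (1 - 2 powr (1 - p - L k)) * e k)"
    using e_pos eventually_sequentially_Suc[THEN iffD2, OF e_pos]
  proof eventually_elim
    case (elim k)
    \<comment> \<open>The constant \<open>c\<close> cancels, so the quotient is positive whatever
      the sign of \<open>c\<close>, and \<open>log2_plus\<close> acts as the logarithm.\<close>
    have ratio: "u k / u (k + 1) = e k / e (Suc k) / q"
      using c q by (simp add: u_eq)
    have "log2_plus (u k / u (k + 1)) = L k - log 2 q"
      using elim q unfolding ratio by (simp add: log2_plus_def L_def log_divide log_mult)
    then have "2 * h k - 1 = L k + (p - 1)"
      by (simp add: h q_def)
    then have hk: "2 * h k = p + L k" by simp
    \<comment> \<open>The estimated power of 2 compensates the geometric factor of
      \<open>u k\<close> up to the error exponent.\<close>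
    have "2 powr (real k * (2 * h k - 1)) * q ^ k = 2 powr (real k * L k)"
      by (simp add: hk q_def powr_power flip: powr_add) (simp add: algebra_simps)
    then show ?case
      using hk unfolding u_eq[of k] by (simp add: algebra_simps)
  qed
  then show ?thesis
    using lim by (simp add: filterlim_cong)
qed

lemma quadratic_variation_mixed_process:
  "quadratic_variation T (mixed_process a b B W) n \<omega> =
     a\<^sup>2 * quadratic_variation T B n \<omega> + 2 * a * b * (\<Sum>i<n. increment T B n i \<omega> * increment T W n i \<omega>)
     + b\<^sup>2 * quadratic_variation T W n \<omega>"
  unfolding quadratic_variation_def sum_distrib_left sum.distrib[symmetric]
  by (intro sum.cong) (auto simp: increment_def mixed_process_def power2_eq_square algebra_simps)

lemma abs_cross_variation_le:
  "\<bar>\<Sum>i<n. increment T B n i \<omega> * increment T W n i \<omega>\<bar> \<le>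
     sqrt (quadratic_variation T B n \<omega> * quadratic_variation T W n \<omega>)"
  unfolding quadratic_variation_def
  by (rule real_le_rsqrt) (use Cauchy_Schwarz_ineq_sum in \<open>simp only: power2_abs\<close>)

theorem proposition3p3:
  fixes M :: "'a measure" and B W :: "real \<Rightarrow> 'a \<Rightarrow> real" and a b T H :: real
  assumes "prob_space M"
    and "T > 0" and "a > 0" and "b > 0"
    and "prob_space.fractional_brownian_motion M T H B"
    and "prob_space.wiener_process M T W"
    and "prob_space.indep_processes M {0..T} B W"
  shows "(H \<in> {0<..<1/2} \<union> {1/2<..<3/4} \<longrightarrow>
           prob_space.strongly_consistent M (a_hat_sq T (mixed_process a b B W)) (a\<^sup>2)) \<and>
         (H \<in> {1/2<..<1} \<longrightarrow>
           prob_space.strongly_consistent M (b_hat_sq T (mixed_process a b B W)) (b\<^sup>2))"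
proof -
  interpret prob_space M by fact
  note T = \<open>T > 0\<close> and fbm = assms(5) and W = assms(6)
  let ?V = "quadratic_variation T (mixed_process a b B W)"
  let ?C = "\<lambda>k \<omega>. \<Sum>i<2^k. increment T B (2^k) i \<omega> * increment T W (2^k) i \<omega>"
  have "strongly_consistent (a_hat_sq T (mixed_process a b B W)) (a\<^sup>2)"
    if "H < 3/4" "H \<noteq> 1/2"
  proof -
    define q where "q = 2 powr (1 - 2 * H)"
    have q: "0 < q" "q \<noteq> 1" using that by (auto simp: q_def)
    have "q\<^sup>2 = 2 powr (2 - 4 * H)"
      by (simp add: q_def powr_power)
    \<comment> \<open>The inequality \<open>- 1 < 2 - 4 * H\<close> is
      \<open>H < 3/4\<close>.\<close>
    moreover have "2 powr (-1) < 2 powr (2 - 4 * H)"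
      using that by (intro powr_less_mono) auto
    ultimately have q2: "1/2 < q\<^sup>2" by (simp add: powr_minus)
    have "AE \<omega> in M. (\<lambda>k. a_hat_sq T (mixed_process a b B W) k \<omega>) \<longlonglongrightarrow> a\<^sup>2"
      using AE_fbm_quadratic_variation_error[OF T fbm, folded q_def]
        AE_cross_variation_error[OF T W fbm assms(7), folded q_def]
        AE_wiener_quadratic_variation_error[OF T W q(1) q2]
    proof eventually_elim
      case (elim \<omega>)
      \<comment> \<open>The leading term of \<open>U_stat\<close> is \<open>c * q ^ k\<close>, from
        \<open>q ^ k - q ^ (k + 1) = (1 - q) * q ^ k\<close>. For \<open>H < 1/2\<close> the
        constant is negative.\<close>
      define c where "c = a\<^sup>2 * T powr (2 * H) * (1 - q)"
      have c: "c \<noteq> 0" using q T \<open>a > 0\<close> by (simp add: c_def)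
      \<comment> \<open>\<open>R\<close> collects the three fluctuations;
        \<open>b\<^sup>2 * T\<close> drops out of the difference of two levels.\<close>
      define R where "R = (\<lambda>k. ?V (2 ^ k) \<omega> - a\<^sup>2 * (T powr (2 * H) * q ^ k) - b\<^sup>2 * T)"
      have "(\<lambda>k. a\<^sup>2 * (real k * (quadratic_variation T B (2 ^ k) \<omega> - T powr (2 * H) * q ^ k) / q ^ k)
          + 2 * a * b * (real k * ?C k \<omega> / q ^ k)
          + b\<^sup>2 * (real k * (quadratic_variation T W (2 ^ k) \<omega> - T) / q ^ k)) \<longlonglongrightarrow>
          a\<^sup>2 * 0 + 2 * a * b * 0 + b\<^sup>2 * 0"
        by (intro tendsto_intros elim)
      also have "(\<lambda>k. a\<^sup>2 * (real k * (quadratic_variation T B (2 ^ k) \<omega> - T powr (2 * H) * q ^ k) / q ^ k)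
          + 2 * a * b * (real k * ?C k \<omega> / q ^ k)
          + b\<^sup>2 * (real k * (quadratic_variation T W (2 ^ k) \<omega> - T) / q ^ k)) = (\<lambda>k. real k * (R k / q ^ k))"
        using q by (simp add: R_def quadratic_variation_mixed_process algebra_simps diff_divide_distrib add_divide_distrib)
      finally have R: "(\<lambda>k. real k * (R k / q ^ k)) \<longlonglongrightarrow> 0" by simp
      have "(\<lambda>k. inverse (real k) * (real k * (R k / q ^ k))) \<longlonglongrightarrow> 0 * 0"
        by (intro tendsto_intros R lim_inverse_n)
      moreover have "\<forall>\<^sub>F k in sequentially. inverse (real k) * (real k * (R k / q ^ k)) = R k / q ^ k"
        using eventually_gt_at_top[of 0] by eventually_elim (simp add: field_simps)
      ultimately have "(\<lambda>k. R k / q ^ k) \<longlonglongrightarrow> 0 * 0"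
        by (rule Lim_transform_eventually)
      then have R0: "(\<lambda>k. R k / q ^ k) \<longlonglongrightarrow> 0"
        by simp
      have Suc_mult: "real (Suc k) * x - x = real k * x" for k and x :: real
        by (simp add: algebra_simps)
      \<comment> \<open>The shifted limit has weight \<open>Suc k\<close>; removing one copy leaves
        the weight \<open>k\<close>.\<close>
      have "(\<lambda>k. real (Suc k) * (R (Suc k) / q ^ Suc k) - R (Suc k) / q ^ Suc k) \<longlonglongrightarrow> 0 - 0"
        by (intro tendsto_diff LIMSEQ_Suc[OF R] LIMSEQ_Suc[OF R0])
      then have R': "(\<lambda>k. real k * (R (Suc k) / q ^ Suc k)) \<longlonglongrightarrow> 0"
        by (simp only: Suc_mult diff_0_right)
      have U: "U_stat T (mixed_process a b B W) k \<omega> = c * q ^ k + (R k - R (Suc k))" for k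
        by (simp add: U_stat_def R_def c_def algebra_simps)
      \<comment> \<open>Normalising \<open>R (Suc k)\<close> by \<open>q ^ k\<close> instead of
        \<open>q ^ Suc k\<close> costs the factor \<open>q\<close>.\<close>
      have "(\<lambda>k. (real k * (R k / q ^ k) - q * (real k * (R (Suc k) / q ^ Suc k))) / c) \<longlonglongrightarrow> (0 - q * 0) / c"
        by (intro tendsto_intros R R' c)
      also have "(\<lambda>k. (real k * (R k / q ^ k) - q * (real k * (R (Suc k) / q ^ Suc k))) / c) =
          (\<lambda>k. real k * (U_stat T (mixed_process a b B W) k \<omega> / (c * q ^ k) - 1))"
        using q c by (simp add: U field_simps)
      finally have "(\<lambda>k. real k * (U_stat T (mixed_process a b B W) k \<omega> / (c * q ^ k) - 1)) \<longlonglongrightarrow> 0"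
        by simp
      from plug_in_estimator_tendsto[where p = "2 * H" and u = "\<lambda>k. U_stat T (mixed_process a b B W) k \<omega>"
          and h = "\<lambda>k. H_tilde T (mixed_process a b B W) k \<omega>", OF c _ T this[unfolded q_def] H_tilde_def] that
      have "(\<lambda>k. a_hat_sq T (mixed_process a b B W) k \<omega>) \<longlonglongrightarrow> c * T powr (- (2 * H)) / (1 - q)"
        by (simp add: a_hat_sq_def Let_def q_def)
      also have "c * T powr (- (2 * H)) / (1 - q) = a\<^sup>2"
        using q T by (simp add: c_def powr_minus field_simps)
      finally show ?case .
    qed
    then show ?thesis by (simp add: strongly_consistent_def)
  qed
  moreover have "strongly_consistent (b_hat_sq T (mixed_process a b B W)) (b\<^sup>2)" if "1/2 < H"
  proof -
    have "AE \<omega> in M. (\<lambda>k. b_hat_sq T (mixed_process a b B W) k \<omega>) \<longlonglongrightarrow> b\<^sup>2"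
      using AE_fbm_quadratic_variation_tendsto_0[OF T fbm that] AE_wiener_quadratic_variation_tendsto[OF T W]
    proof eventually_elim
      case (elim \<omega>)
      \<comment> \<open>This Cauchy-Schwarz bound makes the cross term vanish: its \<open>B\<close>
        factor tends to 0 while its \<open>W\<close> factor converges.\<close>
      have "(\<lambda>k. sqrt (quadratic_variation T B (2^k) \<omega> * quadratic_variation T W (2^k) \<omega>)) \<longlonglongrightarrow> sqrt (0 * T)"
        by (intro tendsto_intros elim)
      then have lim: "(\<lambda>k. sqrt (quadratic_variation T B (2^k) \<omega> * quadratic_variation T W (2^k) \<omega>)) \<longlonglongrightarrow> 0"
        by simp
      have "(\<lambda>k. ?C k \<omega>) \<longlonglongrightarrow> 0"
        by (rule Lim_null_comparison[OF _ lim]) (simp add: abs_cross_variation_le)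
      then have "(\<lambda>k. b_hat_sq T (mixed_process a b B W) k \<omega>) \<longlonglongrightarrow>
          (a\<^sup>2 * 0 + 2 * a * b * 0 + b\<^sup>2 * T) / T"
        unfolding b_hat_sq_def quadratic_variation_mixed_process using T
        by (intro tendsto_intros elim) auto
      then show ?case using T by simp
    qed
    then show ?thesis by (simp add: strongly_consistent_def)
  qed
  ultimately show ?thesis by auto
qed

end
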